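(* Let $A=[a_{ij}]\in\mathbb{C}^{n\times n}$ be a singular irreducible row diagonally dominant matrix, let $\Upsilon$ be the right eigenvector matrix corresponding to the zero eigenvalue of $A$, and let $\Upsilon_C=\mathrm{diag}(\gamma_1/|\gamma_1|,\dots,\gamma_n/|\gamma_n|)$ be its unit-complex matrix (a diagonal unitary matrix), where $\Upsilon=\mathrm{diag}(\gamma_1,\dots,\gamma_n)$. Then $$\Upsilon_C^{-1}A\Upsilon_C=\mathcal{D}(A_C)\,[A_M\circ B_C]=\mathcal{D}(A_C)\,\mu(A),$$ where $B_C=[b'_{ij}]$ is a matrix of unit complex numbers satisfying $b'_{ii}=1$ for all $i$ and $b'_{ij}=-1$ whenever $j\ne i$ and $a_{ij}\neq0$.
   Context: A matrix $A=[a_{ij}]\in\mathbb{C}^{n\times n}$ is row diagonally dominant if $|a_{ii}|\ge\sum_{j\ne i}|a_{ij}|$ for every $i$. The associated directed graph of $A$ has vertices $v_1,\dots,v_n$ and an edge $(v_i,v_j)$ exactly when $a_{ij}\ne0$; $A$ is irreducible if this graph is strongly connected (every vertex is reachable from every other vertex). If $\gamma=(\gamma_1,\dots,\gamma_n)^{T}$ is a right eigenvector corresponding to the zero eigenvalue of $A$ ($A\gamma=0$, $\gamma\ne0$), then $\Upsilon=\mathrm{diag}(\gamma_1,\dots,\gamma_n)$ is called the right eigenvector matrix associated with the zero eigenvalue of $A$; for singular irreducible row diagonally dominant $A$ all $\gamma_i$ are nonzero. $A_M=[|a_{ij}|]$ is the modulus matrix of $A$ and $A_C=[e^{i\theta(a_{ij})}]$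 is its unit-complex matrix, where $a_{ij}=|a_{ij}|e^{i\theta(a_{ij})}$ (for a zero entry the argument is an arbitrary fixed choice), so $A=A_M\circ A_C$, with $\circ$ the Hadamard (entrywise) product. For a square matrix $X$, $\mathcal{D}(X)$ is the diagonal matrix formed by the diagonal entries of $X$; thus $\mathcal{D}(A_C)=\mathrm{diag}(e^{i\theta(a_{11})},\dots,e^{i\theta(a_{nn})})$. The comparison matrix $\mu(A)=[g_{ij}]$ is given by $g_{ii}=|a_{ii}|$ and $g_{ij}=-|a_{ij}|$ for $j\ne i$. *)

theory Defs
  imports "HOL-Analysis.Analysis" "Graph_Theory.Digraph_Component"
begin

definition row_diagonally_dominant :: "complex^'n^'n \<Rightarrow> bool" where
  "row_diagonally_dominant A \<longleftrightarrow> (\<forall>i. cmod (A $ i $ i) \<ge> (\<Sum>j\<in>UNIV - {i}. cmod (A $ i $ j)))"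

definition associated_digraph :: "complex^'n^'n \<Rightarrow> ('n, 'n \<times> 'n) pre_digraph" where
  "associated_digraph A =
     \<lparr>verts = UNIV, arcs = {(i, j). A $ i $ j \<noteq> 0}, tail = fst, head = snd\<rparr>"

(* Every vertex reaches itself by the empty walk, so every 1 x 1 matrix is irreducible,
   including the zero matrix. *)
definition irreducible_matrix :: "complex^'n^'n \<Rightarrow> bool" where
  "irreducible_matrix A \<longleftrightarrow> strongly_connected (associated_digraph A)"

definition right_eigenvector :: "complex^'n^'n \<Rightarrow> complex \<Rightarrow> complex^'n \<Rightarrow> bool" where
  "right_eigenvector A l v \<longleftrightarrow> v \<noteq> 0 \<and> A *v v = l *s v"

definition diag_matrix :: "complex^'n \<Rightarrow> complex^'n^'n" where
  "diag_matrix v = (\<chi> i j. if i = j then v $ i else 0)"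

definition diag_part :: "complex^'n^'n \<Rightarrow> complex^'n^'n" where
  "diag_part X = diag_matrix (\<chi> i. X $ i $ i)"

(* Multiplication on the type of vectors is componentwise, hence entrywise on matrices. *)
abbreviation hadamard :: "complex^'n^'n \<Rightarrow> complex^'n^'n \<Rightarrow> complex^'n^'n"
    (infixl \<open>\<circ>\<^sub>H\<close> 70) where
  "X \<circ>\<^sub>H Y \<equiv> X * Y"

definition modulus_matrix :: "complex^'n^'n \<Rightarrow> complex^'n^'n" where
  "modulus_matrix A = (\<chi> i j. complex_of_real (cmod (A $ i $ j)))"

(* C is a unit-complex matrix of A. This is a relation and not a function of A, because the
   argument of a zero entry may be chosen arbitrarily. *)
definition unit_complex_matrix :: "complex^'n^'n \<Rightarrow> complex^'n^'n \<Rightarrow> bool" where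
  "unit_complex_matrix A C \<longleftrightarrow>
     (\<exists>\<theta> :: real^'n^'n. C = (\<chi> i j. cis (\<theta> $ i $ j)) \<and> A = modulus_matrix A \<circ>\<^sub>H C)"

(* The unit-complex matrix of diag_matrix v; meaningful only if v has no zero component. *)
definition unit_complex_diag :: "complex^'n \<Rightarrow> complex^'n^'n" where
  "unit_complex_diag v = diag_matrix (\<chi> i. v $ i / complex_of_real (cmod (v $ i)))"

definition comparison_matrix :: "complex^'n^'n \<Rightarrow> complex^'n^'n" where
  "comparison_matrix A =
     (\<chi> i j. if i = j then complex_of_real (cmod (A $ i $ i))
             else - complex_of_real (cmod (A $ i $ j)))"

definition unitary_matrix :: "complex^'n^'n \<Rightarrow> bool" where
  "unitary_matrix U \<longleftrightarrow>
     map_matrix cnj (transpose U) ** U = mat 1 \<and> U ** map_matrix cnj (transpose U) = mat 1"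

(* Off-diagonal entries in positions where A vanishes are arbitrary unit complex numbers. *)
definition sign_matrix :: "complex^'n^'n \<Rightarrow> complex^'n^'n \<Rightarrow> bool" where
  "sign_matrix A B \<longleftrightarrow>
     (\<forall>i j. cmod (B $ i $ j) = 1) \<and> (\<forall>i. B $ i $ i = 1) \<and>
     (\<forall>i j. j \<noteq> i \<and> A $ i $ j \<noteq> 0 \<longrightarrow> B $ i $ j = -1)"

end

theory Submission
  imports Defs
begin

text \<open>
  The statement is the equality case of the triangle inequality.  In row \<open>i\<close> of
  \<open>A *v \<gamma> = 0\<close>, the term \<open>a\<^sub>i\<^sub>i \<gamma>\<^sub>i\<close> is balanced by the off-diagonal terms
  \<open>a\<^sub>i\<^sub>j \<gamma>\<^sub>j\<close>.  If \<open>\<bar>\<gamma>\<^sub>i\<bar>\<close> is maximal among the moduli of the entries of \<open>\<gamma>\<close>, diagonal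
  dominance leaves the off-diagonal terms no slack in this balance: all of them point
  in the direction opposite to \<open>a\<^sub>i\<^sub>i \<gamma>\<^sub>i\<close> and have the largest possible modulus
  (\<open>null_vector_aligned_at_maximal_entry\<close>).

  Attaining the largest modulus means that \<open>\<bar>\<gamma>\<^sub>j\<bar> = \<bar>\<gamma>\<^sub>i\<bar>\<close> whenever \<open>a\<^sub>i\<^sub>j \<noteq> 0\<close>, so maximality of the modulus
  is passed on along the edges of the associated digraph.  By irreducibility it reaches every
  vertex, and all entries of \<open>\<gamma>\<close> have the same nonzero modulus
  (\<open>null_vector_constant_modulus\<close>).  The alignment is then available in every row, and
  is exactly the entrywise form of the claimed equation: conjugation by the phases of \<open>\<gamma>\<close>
  turns \<open>a\<^sub>i\<^sub>j\<close> into \<open>- \<bar>a\<^sub>i\<^sub>j\<bar>\<close> times the phase of \<open>a\<^sub>i\<^sub>i\<close>.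
\<close>

text \<open>
  Multiplying row \<open>i\<close> of \<open>A *v v = 0\<close> by \<open>cnj (c * v $ i)\<close> turns the diagonal term into
  \<open>\<bar>a\<^sub>i\<^sub>i\<bar> \<bar>v\<^sub>i\<bar>\<^sup>2\<close>.  Each off-diagonal term has real part at least \<open>- \<bar>a\<^sub>i\<^sub>j\<bar> \<bar>v\<^sub>i\<bar>\<^sup>2\<close>, while by
  dominance the sum of these lower bounds is at least the sum of the terms; so every bound is attained.
  The phase \<open>c\<close> is a parameter because it is not determined by \<open>A\<close> when \<open>a\<^sub>i\<^sub>i = 0\<close>.
\<close>
lemma null_vector_aligned_at_maximal_entry:
  fixes A :: "complex^'n^'n" and v :: "complex^'n"
  assumes dom: "row_diagonally_dominant A"
    and null: "A *v v = 0"
    and max: "\<And>j. cmod (v $ j) \<le> cmod (v $ i)"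
    and c: "cmod c = 1" "A $ i $ i = complex_of_real (cmod (A $ i $ i)) * c"
    and "j \<noteq> i"
  shows "cnj (c * v $ i) * (A $ i $ j * v $ j)
           = - complex_of_real (cmod (A $ i $ j) * (cmod (v $ i))\<^sup>2)"
proof -
  define M where "M = cmod (v $ i)"
  define z where "z k = cnj (c * v $ i) * (A $ i $ k * v $ k)" for k
  have z_le: "cmod (z k) \<le> cmod (A $ i $ k) * M\<^sup>2" for k
  proof -
    have "cmod (z k) = cmod (A $ i $ k) * (M * cmod (v $ k))"
      by (simp add: z_def norm_mult c(1) M_def)
    also have "\<dots> \<le> cmod (A $ i $ k) * (M * M)"
      using max[of k] by (intro mult_left_mono) (auto simp: M_def)
    finally show ?thesis by (simp add: power2_eq_square)
  qed
  have "z i = complex_of_real (cmod (A $ i $ i)) * ((c * cnj c) * (v $ i * cnj (v $ i)))"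
    unfolding z_def by (subst c(2)) (simp add: mult_ac)
  also have "\<dots> = complex_of_real (cmod (A $ i $ i) * M\<^sup>2)"
    using c(1) by (simp add: M_def flip: complex_norm_square)
  finally have z_diag: "z i = complex_of_real (cmod (A $ i $ i) * M\<^sup>2)" .
  have "(\<Sum>k\<in>UNIV. A $ i $ k * v $ k) = 0"
    using null by (simp add: vec_eq_iff matrix_vector_mult_def)
  hence "(\<Sum>k\<in>UNIV. z k) = 0"
    by (simp add: z_def flip: sum_distrib_left)
  hence "z i + (\<Sum>k\<in>UNIV - {i}. z k) = 0"
    by (simp add: sum.remove[of UNIV i])
  hence "Re (z i) + (\<Sum>k\<in>UNIV - {i}. Re (z k)) = 0"
    by (metis Re_sum plus_complex.sel(1) zero_complex.sel(1))
  hence off_diag: "(\<Sum>k\<in>UNIV - {i}. Re (z k)) = - (cmod (A $ i $ i) * M\<^sup>2)"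
    by (simp add: z_diag)
  have nonneg: "0 \<le> cmod (A $ i $ k) * M\<^sup>2 + Re (z k)" for k
    using abs_Re_le_cmod[of "z k"] z_le[of k] by linarith
  have "(\<Sum>k\<in>UNIV - {i}. cmod (A $ i $ k) * M\<^sup>2 + Re (z k))
          = ((\<Sum>k\<in>UNIV - {i}. cmod (A $ i $ k)) - cmod (A $ i $ i)) * M\<^sup>2"
    by (simp add: sum.distrib off_diag sum_distrib_right left_diff_distrib)
  also have "\<dots> \<le> 0"
    using dom by (intro mult_nonpos_nonneg) (auto simp: row_diagonally_dominant_def)
  finally have "(\<Sum>k\<in>UNIV - {i}. cmod (A $ i $ k) * M\<^sup>2 + Re (z k)) = 0"
    by (intro antisym sum_nonneg nonneg)
  hence Re_z: "Re (z j) = - (cmod (A $ i $ j) * M\<^sup>2)"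
    using \<open>j \<noteq> i\<close> nonneg by (subst (asm) sum_nonneg_eq_0_iff) (auto dest!: bspec[of _ _ j])
  \<comment> \<open>The real part already exhausts the modulus, which leaves no room for an imaginary part.\<close>
  have "(cmod (z j))\<^sup>2 \<le> (cmod (A $ i $ j) * M\<^sup>2)\<^sup>2"
    using z_le by (intro power_mono) auto
  hence "(Im (z j))\<^sup>2 \<le> 0"
    by (simp add: cmod_power2 Re_z)
  hence "z j = - complex_of_real (cmod (A $ i $ j) * M\<^sup>2)"
    by (intro complex_eqI) (auto simp: Re_z)
  thus ?thesis by (simp add: z_def M_def)
qed

lemma exists_phase: "\<exists>c. cmod c = 1 \<and> z = complex_of_real (cmod z) * c"
proof (intro exI conjI)
  show "z = complex_of_real (cmod z) * cis (Arg z)"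
    by (metis rcis_cmod_Arg rcis_def)
qed simp

lemma irreducible_matrix_induct [consumes 2, case_names edge]:
  fixes A :: "complex^'n^'n"
  assumes "irreducible_matrix A" and "P i"
    and step: "\<And>j k. P j \<Longrightarrow> A $ j $ k \<noteq> 0 \<Longrightarrow> P k"
  shows "P j"
proof -
  let ?G = "associated_digraph A"
  have "i \<rightarrow>\<^sup>*\<^bsub>?G\<^esub> j"
    using assms(1) by (auto simp: irreducible_matrix_def strongly_connected_def associated_digraph_def)
  hence "(i, j) \<in> rtrancl_on (verts ?G) (arcs_ends ?G)"
    by (simp add: reachable_def)
  thus ?thesis
  proof (induction rule: rtrancl_on_induct)
    case base
    show ?case by fact
  next
    case (step k l)
    hence "A $ k $ l \<noteq> 0"
      by (auto simp: arcs_ends_def arc_to_ends_def associated_digraph_def)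
    thus ?case using step assms(3) by blast
  qed
qed

text \<open>
  Taking moduli in the alignment of a maximal row gives \<open>\<bar>a\<^sub>i\<^sub>j\<bar> \<bar>v\<^sub>i\<bar> \<bar>v\<^sub>j\<bar> = \<bar>a\<^sub>i\<^sub>j\<bar> \<bar>v\<^sub>i\<bar>\<^sup>2\<close>, so the
  neighbours of a vertex at which \<open>\<bar>v\<bar>\<close> is maximal are again such vertices.
\<close>
lemma null_vector_constant_modulus:
  fixes A :: "complex^'n^'n" and v :: "complex^'n"
  assumes irr: "irreducible_matrix A" and dom: "row_diagonally_dominant A"
    and null: "A *v v = 0" and "v \<noteq> 0"
  obtains M where "0 < M" "\<And>j. cmod (v $ j) = M"
proof -
  define M where "M = Max (range (\<lambda>j. cmod (v $ j)))"
  have le: "cmod (v $ j) \<le> M" for j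
    by (auto simp: M_def)
  have "M \<in> range (\<lambda>j. cmod (v $ j))"
    unfolding M_def by (intro Max_in) auto
  then obtain i where i: "cmod (v $ i) = M" by auto
  obtain k where "v $ k \<noteq> 0"
    using \<open>v \<noteq> 0\<close> by (auto simp: vec_eq_iff)
  hence "0 < M"
    using le[of k] by (meson less_le_trans zero_less_norm_iff)
  have "cmod (v $ j) = M" for j
    using irr i
  proof (induction rule: irreducible_matrix_induct)
    case (edge j k)
    show ?case
    proof (cases "k = j")
      case False
      obtain c where c: "cmod c = 1" "A $ j $ j = complex_of_real (cmod (A $ j $ j)) * c"
        using exists_phase by blast
      have "cnj (c * v $ j) * (A $ j $ k * v $ k)
              = - complex_of_real (cmod (A $ j $ k) * (cmod (v $ j))\<^sup>2)"
        using dom null _ c False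
        by (rule null_vector_aligned_at_maximal_entry) (simp add: edge le)
      from arg_cong[OF this, of cmod]
      have "M * (cmod (A $ j $ k) * cmod (v $ k)) = cmod (A $ j $ k) * M\<^sup>2"
        by (simp add: norm_mult norm_power c(1) edge(1) \<open>0 < M\<close>)
      thus ?thesis
        using edge(2) \<open>0 < M\<close> by (simp add: power2_eq_square)
    qed (use edge in simp)
  qed
  with \<open>0 < M\<close> show ?thesis by (rule that)
qed

lemma diag_matrix_mult_left: "(diag_matrix d ** X) $ i $ j = d $ i * X $ i $ j"
  by (simp add: diag_matrix_def matrix_matrix_mult_def if_distrib[of "\<lambda>x. x * _"] cong: if_cong)

lemma diag_matrix_mult_right: "(X ** diag_matrix d) $ i $ j = X $ i $ j * d $ j"
  by (simp add: diag_matrix_def matrix_matrix_mult_def if_distrib[of "\<lambda>x. _ * x"] cong: if_cong)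

lemma adjoint_diag_matrix:
  "map_matrix cnj (transpose (diag_matrix d)) = diag_matrix (\<chi> i. cnj (d $ i))"
  by (simp add: vec_eq_iff map_matrix_def transpose_def diag_matrix_def)

lemma unitary_diag_matrix:
  assumes "\<And>i. cmod (d $ i) = 1"
  shows "unitary_matrix (diag_matrix d)"
proof -
  have "d $ i * cnj (d $ i) = 1" for i
    using assms[of i] by (simp flip: complex_norm_square)
  thus ?thesis
    unfolding unitary_matrix_def adjoint_diag_matrix
    by (auto simp: vec_eq_iff diag_matrix_mult_left)
       (auto simp: diag_matrix_def mat_def mult.commute)
qed

lemma matrix_inv_eqI:
  fixes A :: "'a::semiring_1^'n^'m"
  assumes "A ** B = mat 1" "B ** A = mat 1"
  shows "matrix_inv A = B"
  unfolding matrix_inv_def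
proof (rule some_equality)
  fix C assume "A ** C = mat 1 \<and> C ** A = mat 1"
  thus "C = B"
    using assms by (metis matrix_mul_assoc matrix_mul_lid matrix_mul_rid)
qed (use assms in simp)

lemma unitary_matrix_inv:
  assumes "unitary_matrix U"
  shows "matrix_inv U = map_matrix cnj (transpose U)"
  using assms by (intro matrix_inv_eqI) (auto simp: unitary_matrix_def)

lemma unit_complex_matrix_entry:
  assumes "unit_complex_matrix A C"
  shows "cmod (C $ i $ j) = 1" "A $ i $ j = complex_of_real (cmod (A $ i $ j)) * C $ i $ j"
proof -
  obtain \<theta> :: "real^'a^'a" where C: "C = (\<chi> i j. cis (\<theta> $ i $ j))" and A: "A = modulus_matrix A * C"
    using assms by (auto simp: unit_complex_matrix_def)
  show "cmod (C $ i $ j) = 1"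
    by (simp add: C)
  show "A $ i $ j = complex_of_real (cmod (A $ i $ j)) * C $ i $ j"
    by (subst A) (simp add: modulus_matrix_def)
qed

lemma modulus_hadamard_sign_matrix:
  assumes "sign_matrix A B"
  shows "modulus_matrix A \<circ>\<^sub>H B = comparison_matrix A"
proof -
  have "complex_of_real (cmod (A $ i $ j)) * B $ i $ j = - complex_of_real (cmod (A $ i $ j))"
    if "j \<noteq> i" for i j
    using assms that by (cases "A $ i $ j = 0") (auto simp: sign_matrix_def)
  thus ?thesis
    using assms by (auto simp: vec_eq_iff modulus_matrix_def comparison_matrix_def sign_matrix_def)
qed

theorem theorem3p2:
  fixes A A\<^sub>C B\<^sub>C :: "complex^'n^'n" and \<gamma> :: "complex^'n"
  assumes "\<not> invertible A"
    and "irreducible_matrix A"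
    and "row_diagonally_dominant A"
    and "right_eigenvector A 0 \<gamma>"
    and "unit_complex_matrix A A\<^sub>C"
    and "sign_matrix A B\<^sub>C"
  shows "unitary_matrix (unit_complex_diag \<gamma>) \<and>
    matrix_inv (unit_complex_diag \<gamma>) ** A ** unit_complex_diag \<gamma>
      = diag_part A\<^sub>C ** (modulus_matrix A \<circ>\<^sub>H B\<^sub>C) \<and>
    diag_part A\<^sub>C ** (modulus_matrix A \<circ>\<^sub>H B\<^sub>C) = diag_part A\<^sub>C ** comparison_matrix A"
proof -
  have null: "A *v \<gamma> = 0" and "\<gamma> \<noteq> 0"
    using assms(4) by (auto simp: right_eigenvector_def)
  obtain M where "0 < M" and M: "\<And>j. cmod (\<gamma> $ j) = M"
    using null_vector_constant_modulus[OF assms(2,3) null \<open>\<gamma> \<noteq> 0\<close>] by blast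
  define u where "u = (\<chi> i. \<gamma> $ i / complex_of_real M)"
  have U: "unit_complex_diag \<gamma> = diag_matrix u"
    by (simp add: unit_complex_diag_def u_def M)
  have u_norm: "cmod (u $ i) = 1" for i
    using \<open>0 < M\<close> by (simp add: u_def M norm_divide)
  hence unitary: "unitary_matrix (unit_complex_diag \<gamma>)"
    unfolding U by (rule unitary_diag_matrix)
  have null_u: "A *v u = 0"
  proof -
    have "u = (1 / complex_of_real M) *s \<gamma>"
      by (simp add: u_def vec_eq_iff)
    thus ?thesis by (simp add: vector_scalar_commute null)
  qed
  have "cnj (u $ i) * A $ i $ j * u $ j = A\<^sub>C $ i $ i * comparison_matrix A $ i $ j" for i j
  proof -
    note c = unit_complex_matrix_entry[OF assms(5), of i i]
    show ?thesis
    proof (cases "j = i")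
      case True
      have "cnj (u $ i) * u $ i = 1"
        using u_norm[of i] by (simp add: mult.commute flip: complex_norm_square)
      hence "cnj (u $ i) * A $ i $ i * u $ i = A $ i $ i"
        by (metis mult.assoc mult.commute mult_1)
      thus ?thesis
        using c(2) True by (simp add: comparison_matrix_def mult.commute)
    next
      case False
      have "cnj (A\<^sub>C $ i $ i * u $ i) * (A $ i $ j * u $ j)
              = - complex_of_real (cmod (A $ i $ j) * (cmod (u $ i))\<^sup>2)"
        using assms(3) null_u _ c False
        by (rule null_vector_aligned_at_maximal_entry) (simp add: u_norm)
      hence "A\<^sub>C $ i $ i * (cnj (A\<^sub>C $ i $ i * u $ i) * (A $ i $ j * u $ j))
               = A\<^sub>C $ i $ i * comparison_matrix A $ i $ j"
        using False by (simp add: u_norm comparison_matrix_def)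
      moreover have "A\<^sub>C $ i $ i * (cnj (A\<^sub>C $ i $ i * u $ i) * (A $ i $ j * u $ j))
          = (A\<^sub>C $ i $ i * cnj (A\<^sub>C $ i $ i)) * (cnj (u $ i) * A $ i $ j * u $ j)"
        by (simp add: mult_ac)
      moreover have "A\<^sub>C $ i $ i * cnj (A\<^sub>C $ i $ i) = 1"
        using c(1) by (simp flip: complex_norm_square)
      ultimately show ?thesis by (metis mult_1)
    qed
  qed
  hence "matrix_inv (unit_complex_diag \<gamma>) ** A ** unit_complex_diag \<gamma>
           = diag_part A\<^sub>C ** comparison_matrix A"
    using unitary unfolding U
    by (simp add: unitary_matrix_inv adjoint_diag_matrix diag_part_def vec_eq_iff
        diag_matrix_mult_left diag_matrix_mult_right)
  with unitary show ?thesis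
    by (simp add: modulus_hadamard_sign_matrix[OF assms(6)])
qed

end
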